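(* Let $\mathbf{P}=(P_1,\ldots,P_n)^\top:\mathbb{R}^n\to\mathbb{R}^n$ be a polynomial map, where each $P_i$ is a homogeneous polynomial of degree $d\ge1$ with nonnegative coefficients. Assume that $\mathbf{P}$ is weakly irreducible. Then the unique scalar $\lambda$ such that there is a positive vector $\mathbf{u}>\mathbf 0$ with $P_i(\mathbf{u})=\lambda u_i^d$ for all $i\in[n]$ satisfies $$\lambda=\inf_{\mathbf{x}\in\operatorname{int}\mathbb{R}_+^n}\ \max_{i\in[n]}\frac{P_i(\mathbf{x})}{x_i^d}=\sup_{\mathbf{x}\in\mathbb{R}_+^n\setminus\{\mathbf 0\}}\ \min_{i\in[n],\ x_i\ne0}\frac{P_i(\mathbf{x})}{x_i^d}.$$
   Context: $[n]=\{1,\ldots,n\}$; $\operatorname{int}\mathbb{R}_+^n$ is the set of vectors with all coordinates positive. The di-graph $G(\mathbf{P})$ (for $P_i$ homogeneous) has vertex set $[n]$, and $(i,j)$ is a di-edge if and only if the variable $x_j$ effectively appears in $P_i$ (in a monomial with nonzero coefficient). $\mathbf{P}$ is weakly irreducible if $G(\mathbf{P})$ is strongly connected. (Such a scalar $\lambda$ exists and is unique under these hypotheses.) *)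

theory Defs
  imports
    "Graph_Theory.Pair_Digraph"
    "Graph_Theory.Digraph_Component"
    "HOL-Library.Poly_Mapping"
    "HOL-Library.Extended_Real"
    "HOL-Analysis.Analysis"
begin

text \<open>
  Real polynomials in variables indexed by \<open>'n\<close>: finitely supported maps from exponent vectors
  to coefficients.
\<close>

type_synonym 'n real_mpoly = "('n \<Rightarrow>\<^sub>0 nat) \<Rightarrow>\<^sub>0 real"

definition mpoly_eval :: "'n::finite real_mpoly \<Rightarrow> real ^ 'n \<Rightarrow> real" where
  "mpoly_eval p x =
    (\<Sum>m \<in> Poly_Mapping.keys p.
      Poly_Mapping.lookup p m * (\<Prod>j\<in>UNIV. (x $ j) ^ Poly_Mapping.lookup m j))"

text \<open>As usual, the zero polynomial is homogeneous of every degree.\<close>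

definition homogeneous :: "nat \<Rightarrow> 'n::finite real_mpoly \<Rightarrow> bool" where
  "homogeneous d p \<longleftrightarrow>
    (\<forall>m \<in> Poly_Mapping.keys p. (\<Sum>j\<in>UNIV. Poly_Mapping.lookup m j) = d)"

definition nonneg_coeffs :: "'n real_mpoly \<Rightarrow> bool" where
  "nonneg_coeffs p \<longleftrightarrow> (\<forall>m. 0 \<le> Poly_Mapping.lookup p m)"

definition appears_in :: "'n \<Rightarrow> 'n real_mpoly \<Rightarrow> bool" where
  "appears_in j p \<longleftrightarrow> (\<exists>m \<in> Poly_Mapping.keys p. 0 < Poly_Mapping.lookup m j)"

definition poly_map :: "('n::finite real_mpoly) ^ 'n \<Rightarrow> real ^ 'n \<Rightarrow> real ^ 'n" where
  "poly_map P x = (\<chi> i. mpoly_eval (P $ i) x)"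

definition dependency_digraph :: "('n::finite real_mpoly) ^ 'n \<Rightarrow> 'n pair_pre_digraph" where
  "dependency_digraph P = \<lparr> pverts = UNIV, parcs = {(i, j). appears_in j (P $ i)} \<rparr>"

text \<open>
  Vertices are reachable from themselves by the empty walk, so for a single variable the
  digraph is strongly connected even without a loop.
\<close>

definition weakly_irreducible :: "('n::finite real_mpoly) ^ 'n \<Rightarrow> bool" where
  "weakly_irreducible P \<longleftrightarrow> strongly_connected (with_proj (dependency_digraph P))"

definition nonneg_orthant :: "(real ^ 'n) set" where
  "nonneg_orthant = {x. \<forall>i. 0 \<le> x $ i}"

definition pos_orthant :: "(real ^ 'n) set" where
  "pos_orthant = {x. \<forall>i. 0 < x $ i}"

definition has_positive_eigenvector :: "nat \<Rightarrow> ('n::finite real_mpoly) ^ 'n \<Rightarrow> real \<Rightarrow> bool" where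
  "has_positive_eigenvector d P l \<longleftrightarrow>
    (\<exists>u \<in> pos_orthant. \<forall>i. poly_map P u $ i = l * (u $ i) ^ d)"

end

theory Submission
  imports Defs
begin

text \<open>
  The function \<open>f x = max\<^sub>i P\<^sub>i(x) / x\<^sub>i\<^sup>d\<close> is invariant under scaling. Normalise \<open>min\<^sub>i x\<^sub>i = 1\<close>: an edge
  \<open>(i, j)\<close> gives \<open>c x\<^sub>j \<le> P\<^sub>i(x) \<le> f(x) x\<^sub>i\<^sup>d\<close>, so strong connectivity bounds every sublevel set of
  \<open>f\<close>, and \<open>f\<close> attains its minimum \<open>\<lambda>\<close> on the positive orthant. At a minimiser every ratio
  equals \<open>\<lambda>\<close>: otherwise, shrinking slightly the coordinates with ratio below \<open>\<lambda>\<close> makes the ratio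
  strict at a vertex with an edge into this set, and repeating this produces a point with
  \<open>f < \<lambda>\<close>. Both variational formulas, and with them uniqueness, follow by comparing \<open>x\<close> with the
  multiple of the eigenvector that touches it from below (respectively above).
\<close>

section \<open>Monotonicity, scaling and growth of polynomials with nonnegative coefficients\<close>

lemma mpoly_eval_mono:
  assumes p: "nonneg_coeffs p" and x: "\<And>i. 0 \<le> x $ i" and xy: "\<And>i. x $ i \<le> y $ i"
  shows "mpoly_eval p x \<le> mpoly_eval p y"
  unfolding mpoly_eval_def
proof (rule sum_mono)
  fix m
  have "(\<Prod>j\<in>UNIV. (x $ j) ^ Poly_Mapping.lookup m j) \<le> (\<Prod>j\<in>UNIV. (y $ j) ^ Poly_Mapping.lookup m j)"
    using x xy by (intro prod_mono) (simp add: power_mono)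
  then show "Poly_Mapping.lookup p m * (\<Prod>j\<in>UNIV. (x $ j) ^ Poly_Mapping.lookup m j)
      \<le> Poly_Mapping.lookup p m * (\<Prod>j\<in>UNIV. (y $ j) ^ Poly_Mapping.lookup m j)"
    using p by (simp add: nonneg_coeffs_def mult_left_mono)
qed

text \<open>In a monomial containing the variable \<open>j\<close> the other factors stay positive,
  so that monomial increases strictly; no other monomial decreases.\<close>

lemma mpoly_eval_strict_mono:
  assumes p: "nonneg_coeffs p" and x: "\<And>i. 0 < x $ i" and xy: "\<And>i. x $ i \<le> y $ i"
    and j: "appears_in j p" "x $ j < y $ j"
  shows "mpoly_eval p x < mpoly_eval p y"
proof -
  obtain m where m: "m \<in> Poly_Mapping.keys p" "0 < Poly_Mapping.lookup m j"
    using j by (auto simp: appears_in_def)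
  have le: "(\<Prod>j\<in>UNIV. (x $ j) ^ Poly_Mapping.lookup k j) \<le> (\<Prod>j\<in>UNIV. (y $ j) ^ Poly_Mapping.lookup k j)" for k
    using x xy by (intro prod_mono) (simp add: power_mono less_imp_le)
  have y: "0 < y $ i" for i
    using x[of i] xy[of i] by linarith
  have "(\<Prod>j\<in>UNIV. (x $ j) ^ Poly_Mapping.lookup m j) < (\<Prod>j\<in>UNIV. (y $ j) ^ Poly_Mapping.lookup m j)"
  proof (rule prod_mono_strict[where i = j])
    show "x $ j ^ Poly_Mapping.lookup m j < y $ j ^ Poly_Mapping.lookup m j"
      using m j x by (simp add: power_strict_mono less_imp_le)
  qed (use x xy y in \<open>auto simp: power_mono less_imp_le\<close>)
  moreover have "0 < Poly_Mapping.lookup p m"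
    using m p by (metis nonneg_coeffs_def in_keys_iff order_le_less)
  ultimately show ?thesis
    unfolding mpoly_eval_def using p m
    by (intro sum_strict_mono_ex1)
       (auto intro!: mult_left_mono le mult_strict_left_mono bexI[of _ m] simp: nonneg_coeffs_def)
qed

lemma mpoly_eval_scale:
  assumes "homogeneous d p"
  shows "mpoly_eval p (c *\<^sub>R x) = c ^ d * mpoly_eval p x"
proof -
  have "Poly_Mapping.lookup p m * (\<Prod>j\<in>UNIV. ((c *\<^sub>R x) $ j) ^ Poly_Mapping.lookup m j) =
      c ^ d * (Poly_Mapping.lookup p m * (\<Prod>j\<in>UNIV. (x $ j) ^ Poly_Mapping.lookup m j))" if "m \<in> Poly_Mapping.keys p" for m
    using assms that
    by (simp add: homogeneous_def power_mult_distrib prod.distrib flip: power_sum)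
  then show ?thesis
    unfolding mpoly_eval_def sum_distrib_left by (rule sum.cong[OF refl])
qed

lemma continuous_on_mpoly_eval [continuous_intros]:
  "continuous_on S f \<Longrightarrow> continuous_on S (\<lambda>x. mpoly_eval p (f x))"
  unfolding mpoly_eval_def by (intro continuous_intros)

text \<open>Take for \<open>c\<close> the coefficient of one monomial containing the variable
  \<open>j\<close>. With all coordinates at least 1, the remaining factors only enlarge this
  monomial, and the other monomials contribute nonnegative amounts.\<close>

lemma mpoly_eval_ge_coordinate:
  assumes p: "nonneg_coeffs p" and j: "appears_in j p"
  obtains c where "0 < c" "\<And>x. (\<And>i. 1 \<le> x $ i) \<Longrightarrow> c * x $ j \<le> mpoly_eval p x"
proof -
  obtain m where m: "m \<in> Poly_Mapping.keys p" "0 < Poly_Mapping.lookup m j"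
    using j by (auto simp: appears_in_def)
  have c: "0 < Poly_Mapping.lookup p m"
    using m p by (metis nonneg_coeffs_def in_keys_iff order_le_less)
  have "Poly_Mapping.lookup p m * x $ j \<le> mpoly_eval p x" if x: "\<And>i. 1 \<le> x $ i" for x :: "real ^ 'a"
  proof -
    have x0: "0 \<le> x $ i" for i
      using x[of i] by linarith
    have "x $ j \<le> x $ j ^ Poly_Mapping.lookup m j"
      using m x by (simp add: self_le_power)
    also have "\<dots> = (\<Prod>i\<in>{j}. x $ i ^ Poly_Mapping.lookup m i)"
      by simp
    also have "\<dots> \<le> (\<Prod>i\<in>UNIV. x $ i ^ Poly_Mapping.lookup m i)"
      using x x0 by (intro prod_mono2) (auto simp: one_le_power)
    finally have "Poly_Mapping.lookup p m * x $ j \<le> Poly_Mapping.lookup p m * (\<Prod>i\<in>UNIV. x $ i ^ Poly_Mapping.lookup m i)"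
      using c by simp
    also have "\<dots> \<le> mpoly_eval p x"
      unfolding mpoly_eval_def using m p x0
      by (intro member_le_sum[where f = "\<lambda>m. Poly_Mapping.lookup p m * (\<Prod>i\<in>UNIV. x $ i ^ Poly_Mapping.lookup m i)"])
         (auto simp: nonneg_coeffs_def intro!: mult_nonneg_nonneg prod_nonneg)
    finally show ?thesis .
  qed
  with c that show thesis
    by blast
qed

lemma continuous_on_Max:
  fixes f :: "'i \<Rightarrow> 'a::topological_space \<Rightarrow> 'b::linorder_topology"
  assumes "finite I" "I \<noteq> {}" "\<And>i. i \<in> I \<Longrightarrow> continuous_on S (f i)"
  shows "continuous_on S (\<lambda>x. MAX i\<in>I. f i x)"
  using assms by (induction rule: finite_ne_induct) (auto intro!: continuous_on_max)

section \<open>Walks in the dependency digraph\<close>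

lemma dependency_reachable:
  assumes "weakly_irreducible P"
  shows "(i, j) \<in> {(i, j). appears_in j (P $ i)}\<^sup>*"
proof -
  have "arcs_ends (with_proj (dependency_digraph P)) = {(i, j). appears_in j (P $ i)}"
    by (auto simp: arcs_ends_def arc_to_ends_def dependency_digraph_def image_iff)
  moreover have "i \<rightarrow>\<^sup>*\<^bsub>with_proj (dependency_digraph P)\<^esub> j"
    using assms by (auto simp: weakly_irreducible_def strongly_connected_def dependency_digraph_def)
  ultimately show ?thesis
    using rtrancl_on_rtranclI by (metis reachable_def)
qed

text \<open>A walk from \<open>i\<close> to a vertex outside \<open>I\<close> has to leave
  \<open>I\<close> along some edge.\<close>

lemma dependency_edge_leaving:
  assumes "weakly_irreducible P" and "i \<in> I" "I \<noteq> UNIV"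
  obtains a b where "a \<in> I" "b \<notin> I" "appears_in b (P $ a)"
proof -
  obtain j where "j \<notin> I"
    using assms by auto
  moreover have "j \<in> I \<or> (\<exists>a\<in>I. \<exists>b. b \<notin> I \<and> appears_in b (P $ a))"
    using dependency_reachable[OF assms(1), of i j]
    by (induction rule: rtrancl_induct) (use assms in auto)
  ultimately show thesis
    using that by blast
qed

section \<open>Minimising the largest ratio over the positive orthant\<close>

context
  fixes P :: "('n::finite real_mpoly) ^ 'n" and d :: nat
  assumes hom: "\<And>i. homogeneous d (P $ i)"
    and nonneg: "\<And>i. nonneg_coeffs (P $ i)"
begin

text \<open>The bound spreads along a walk from \<open>i\<close> to \<open>j\<close>: an edge
  \<open>(a, b)\<close> turns a bound on \<open>x $ a\<close> into one on \<open>x $ b\<close>. The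
  constant depends on the walk and on \<open>L\<close>, not on \<open>x\<close>.\<close>

lemma poly_map_supersolution_coordinate_bound:
  assumes reach: "(i, j) \<in> {(i, j). appears_in j (P $ i)}\<^sup>*"
  shows "\<exists>C. \<forall>x. (\<forall>k. 1 \<le> x $ k) \<longrightarrow> x $ i = 1 \<longrightarrow>
    (\<forall>k. poly_map P x $ k \<le> L * x $ k ^ d) \<longrightarrow> x $ j \<le> C"
  using reach
proof (induction rule: rtrancl_induct)
  case base
  then show ?case
    by (intro exI[of _ 1]) simp
next
  case (step a b)
  obtain C where C: "\<And>x. (\<forall>k. 1 \<le> x $ k) \<Longrightarrow> x $ i = 1 \<Longrightarrow>
    (\<forall>k. poly_map P x $ k \<le> L * x $ k ^ d) \<Longrightarrow> x $ a \<le> C"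
    using step.IH by blast
  obtain c where c: "0 < c" "\<And>x. (\<And>i. 1 \<le> x $ i) \<Longrightarrow> c * x $ b \<le> mpoly_eval (P $ a) x"
    using mpoly_eval_ge_coordinate[OF nonneg] step.hyps(2) by blast
  have "x $ b \<le> \<bar>L\<bar> * C ^ d / c"
    if x: "\<forall>k. 1 \<le> x $ k" "x $ i = 1" "\<forall>k. poly_map P x $ k \<le> L * x $ k ^ d" for x
  proof -
    have x0: "0 \<le> x $ a"
      using x(1) by (meson order_trans zero_le_one)
    have "c * x $ b \<le> L * x $ a ^ d"
      using c(2)[of x] x(1,3) by (auto simp: poly_map_def intro: order_trans)
    \<comment> \<open>The sign of \<open>L\<close> is arbitrary here; the absolute value lets
      \<open>x $ a\<close> be replaced by its upper bound \<open>C\<close>.\<close>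
    also have "\<dots> \<le> \<bar>L\<bar> * x $ a ^ d"
      using x0 by (intro mult_right_mono) auto
    also have "\<dots> \<le> \<bar>L\<bar> * C ^ d"
      using C[OF x] x0 by (intro mult_left_mono power_mono) auto
    finally show ?thesis
      using c(1) by (simp add: field_simps)
  qed
  then show ?case
    by blast
qed

lemma poly_map_max_ratio_attains_min:
  assumes irr: "weakly_irreducible P"
  obtains z where "z \<in> pos_orthant"
    "\<And>x. x \<in> pos_orthant \<Longrightarrow>
      (MAX i. poly_map P z $ i / z $ i ^ d) \<le> (MAX i. poly_map P x $ i / x $ i ^ d)"
proof -
  define f where "f x = (MAX i. poly_map P x $ i / x $ i ^ d)" for x :: "real ^ 'n"
  define L where "L = f (\<chi> i. 1)"
  have "\<exists>C. \<forall>i j x. (\<forall>k. 1 \<le> x $ k) \<longrightarrow> x $ i = 1 \<longrightarrow>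
      (\<forall>k. poly_map P x $ k \<le> L * x $ k ^ d) \<longrightarrow> x $ j \<le> C"
  proof -
    obtain B where B: "\<And>i j x. (\<forall>k. 1 \<le> x $ k) \<Longrightarrow> x $ i = 1 \<Longrightarrow>
      (\<forall>k. poly_map P x $ k \<le> L * x $ k ^ d) \<Longrightarrow> x $ j \<le> B i j"
      using poly_map_supersolution_coordinate_bound[OF dependency_reachable[OF irr], where L = L]
      by metis
    have "B i j \<le> Max (range (case_prod B))" for i j
      by (intro Max_ge) (auto intro: rev_image_eqI[of "(i, j)"])
    with B show ?thesis
      by (meson order_trans)
  qed
  then obtain C0 where C0: "\<And>i j x. (\<forall>k. 1 \<le> x $ k) \<Longrightarrow> x $ i = 1 \<Longrightarrow>
      (\<forall>k. poly_map P x $ k \<le> L * x $ k ^ d) \<Longrightarrow> x $ j \<le> C0"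
    by blast
  \<comment> \<open>The lower corner keeps the denominators away from 0, so \<open>f\<close> is
    continuous on this compact box; \<open>max 1 C0\<close> puts the all-ones point, where
    \<open>f\<close> equals \<open>L\<close>, inside it.\<close>
  define K where "K = (cbox (\<chi> i. 1) (\<chi> i. max 1 C0) :: (real ^ 'n) set)"
  have memK: "x \<in> K \<longleftrightarrow> (\<forall>i. 1 \<le> x $ i \<and> x $ i \<le> max 1 C0)" for x
    by (simp add: K_def mem_box_cart)
  have one: "(\<chi> i. 1) \<in> K"
    by (simp add: memK)
  have nz: "x $ i \<noteq> 0" if "x \<in> K" for x i
    using that by (metis memK not_one_le_zero)
  have cont: "continuous_on K f"
    unfolding f_def poly_map_def vec_lambda_beta
    by (intro continuous_on_Max continuous_intros) (auto simp: nz)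
  obtain z where z: "z \<in> K" "\<And>y. y \<in> K \<Longrightarrow> f z \<le> f y"
    using continuous_attains_inf[OF _ _ cont] one by (auto simp: K_def)
  have "f z \<le> f x" if x: "x \<in> pos_orthant" for x
  proof -
    define t where "t = (MIN i. x $ i)"
    have "t \<in> range (\<lambda>i. x $ i)"
      unfolding t_def by (intro Min_in) auto
    then obtain i where i: "t = x $ i"
      by blast
    have t: "t \<le> x $ k" for k
      unfolding t_def by simp
    have t0: "0 < t"
      using i x by (simp add: pos_orthant_def)
    \<comment> \<open>Rescaling makes the smallest coordinate 1; by homogeneity no ratio
      changes.\<close>
    define y where "y = inverse t *\<^sub>R x"
    have y: "\<forall>k. 1 \<le> y $ k" "y $ i = 1"
      using t t0 i by (auto simp: y_def field_simps)
    have "poly_map P y $ k / y $ k ^ d = poly_map P x $ k / x $ k ^ d" for k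
      using t0 by (simp add: y_def poly_map_def mpoly_eval_scale[OF hom] power_mult_distrib)
    then have fy: "f y = f x"
      by (simp add: f_def)
    show ?thesis
    \<comment> \<open>Below the level \<open>L\<close> the rescaled point lies in \<open>K\<close>;
      above it, the all-ones point already does better than \<open>x\<close>.\<close>
    proof (cases "f x \<le> L")
      case True
      have "poly_map P y $ k \<le> L * y $ k ^ d" for k
      proof -
        have "poly_map P y $ k / y $ k ^ d \<le> f y"
          unfolding f_def by (intro Max_ge) auto
        with True fy have "poly_map P y $ k / y $ k ^ d \<le> L"
          by simp
        moreover have "0 < y $ k ^ d"
          using y(1) by (meson zero_less_power less_le_trans zero_less_one)
        ultimately show ?thesis
          by (simp add: pos_divide_le_eq)
      qed
      then have "y \<in> K"
        using C0[OF y] y(1) by (auto simp: memK intro: le_max_iff_disj[THEN iffD2])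
      with z(2) fy show ?thesis
        by fastforce
    next
      case False
      with z(2)[OF one] show ?thesis
        by (simp add: L_def)
    qed
  qed
  moreover have "z \<in> pos_orthant"
    using z(1) by (force simp: memK pos_orthant_def intro: less_le_trans[OF zero_less_one])
  ultimately show thesis
    using that unfolding f_def by blast
qed

section \<open>From a minimiser to a positive eigenvector\<close>

text \<open>Induction on the number of indices with equality: each round perturbs \<open>x\<close>
  so that the set of these indices loses at least one element and gains none.\<close>

lemma poly_map_strict_supersolution:
  assumes irr: "weakly_irreducible P"
    and "x \<in> pos_orthant" "\<And>i. poly_map P x $ i \<le> l * x $ i ^ d"
    and "poly_map P x $ k < l * x $ k ^ d"
  obtains y where "y \<in> pos_orthant" "\<And>i. poly_map P y $ i < l * y $ i ^ d"
  using assms(2-)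
proof (induction "card {i. poly_map P x $ i = l * x $ i ^ d}" arbitrary: x k thesis
    rule: less_induct)
  case less
  define I where "I = {i. poly_map P x $ i = l * x $ i ^ d}"
  have outside: "poly_map P x $ i < l * x $ i ^ d" if "i \<notin> I" for i
    using less.prems(3)[of i] that by (simp add: I_def)
  show ?case
  proof (cases "I = {}")
    case True
    with outside less.prems(1,2) show ?thesis
      by blast
  next
    case False
    have "k \<notin> I"
      using less.prems(4) by (simp add: I_def)
    then have "I \<noteq> UNIV"
      by blast
    moreover from False obtain i where "i \<in> I"
      by blast
    ultimately obtain a b where ab: "a \<in> I" "b \<notin> I" "appears_in b (P $ a)"
      using dependency_edge_leaving[OF irr] by blast
    \<comment> \<open>Shrinking only coordinates outside \<open>I\<close> leaves the right-hand
      sides at indices in \<open>I\<close> unchanged, while their left-hand sides cannot grow; at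
      \<open>a\<close> the left-hand side drops strictly, because of \<open>b\<close>.\<close>
    define y where "y s = (\<chi> i. if i \<in> I then x $ i else s * x $ i)" for s :: real
    \<comment> \<open>Since \<open>y 1 = x\<close>, the finitely many strict inequalities survive
      for \<open>s\<close> just below 1.\<close>
    have "eventually (\<lambda>s. \<forall>i. i \<notin> I \<longrightarrow> poly_map P (y s) $ i < l * y s $ i ^ d) (at_left 1)"
    proof (rule eventually_all_finite)
      fix i
      have "continuous_on UNIV y"
        unfolding y_def
      proof (intro continuous_on_vec_lambda)
        show "continuous_on UNIV (\<lambda>s. if j \<in> I then x $ j else s * x $ j)" for j
          by (cases "j \<in> I") (auto intro!: continuous_intros)
      qed
      then have "continuous_on UNIV (\<lambda>s. l * y s $ i ^ d - poly_map P (y s) $ i)"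
        unfolding poly_map_def vec_lambda_beta by (intro continuous_intros)
      then have "((\<lambda>s. l * y s $ i ^ d - poly_map P (y s) $ i)
          \<longlongrightarrow> l * y 1 $ i ^ d - poly_map P (y 1) $ i) (at_left 1)"
        by (meson continuous_on_def iso_tuple_UNIV_I tendsto_within_subset subset_UNIV)
      moreover have "y 1 = x"
        by (simp add: y_def vec_eq_iff)
      ultimately have "i \<notin> I \<Longrightarrow>
          eventually (\<lambda>s. 0 < l * y s $ i ^ d - poly_map P (y s) $ i) (at_left 1)"
        using outside[of i] by (intro order_tendstoD(1)) auto
      then show "eventually (\<lambda>s. i \<notin> I \<longrightarrow> poly_map P (y s) $ i < l * y s $ i ^ d) (at_left 1)"
        by (cases "i \<in> I") simp_all
    qed
    moreover have "eventually (\<lambda>s::real. s \<in> {0<..<1}) (at_left 1)"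
      by (intro eventually_at_left_real) simp
    ultimately have "\<exists>s. (\<forall>i. i \<notin> I \<longrightarrow> poly_map P (y s) $ i < l * y s $ i ^ d) \<and> s \<in> {0<..<1}"
      by (intro eventually_happens'[of "at_left 1"] eventually_conj) simp_all
    then obtain s where s: "0 < s" "s < 1"
        and out: "\<And>i. i \<notin> I \<Longrightarrow> poly_map P (y s) $ i < l * y s $ i ^ d"
      by auto
    have xpos: "0 < x $ i" for i
      using less.prems(2) by (simp add: pos_orthant_def)
    have ypos: "0 < y s $ i" and yx: "y s $ i \<le> x $ i" for i
      using s xpos[of i] by (auto simp: y_def mult_left_le_one_le)
    have yb: "y s $ b < x $ b"
      using ab(2) s xpos[of b] by (simp add: y_def)
    have yle: "poly_map P (y s) $ i \<le> l * y s $ i ^ d" for i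
    proof (cases "i \<in> I")
      case True
      have "poly_map P (y s) $ i \<le> poly_map P x $ i"
        using ypos yx by (simp add: poly_map_def mpoly_eval_mono[OF nonneg] less_imp_le)
      with True show ?thesis
        by (simp add: I_def y_def)
    qed (use out less_imp_le in blast)
    have ya: "poly_map P (y s) $ a < l * y s $ a ^ d"
    proof -
      have "poly_map P (y s) $ a < poly_map P x $ a"
        using mpoly_eval_strict_mono[OF nonneg ypos yx ab(3) yb] by (simp add: poly_map_def)
      with ab(1) show ?thesis
        by (simp add: I_def y_def)
    qed
    have "{i. poly_map P (y s) $ i = l * y s $ i ^ d} \<subset> I"
      using out ya ab(1) by (auto simp: order_less_le)
    then have "card {i. poly_map P (y s) $ i = l * y s $ i ^ d} < card I"
      by (intro psubset_card_mono) auto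
    from less.hyps[OF this[unfolded I_def] less.prems(1) _ yle ya] ypos show ?thesis
      by (simp add: pos_orthant_def)
  qed
qed

text \<open>If a minimiser of the largest ratio had unequal ratios, the strict supersolution built
  from it would have a smaller largest ratio.\<close>

lemma poly_map_positive_eigenvector_exists:
  assumes irr: "weakly_irreducible P"
  obtains l where "has_positive_eigenvector d P l"
proof -
  obtain z where z: "z \<in> pos_orthant" and min: "\<And>x. x \<in> pos_orthant \<Longrightarrow>
      (MAX i. poly_map P z $ i / z $ i ^ d) \<le> (MAX i. poly_map P x $ i / x $ i ^ d)"
    using poly_map_max_ratio_attains_min[OF irr] by blast
  define l where "l = (MAX i. poly_map P z $ i / z $ i ^ d)"
  have pow: "0 < x $ i ^ d" if "x \<in> pos_orthant" for x :: "real ^ 'n" and i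
    using that by (simp add: pos_orthant_def)
  have le: "poly_map P z $ i \<le> l * z $ i ^ d" for i
  proof -
    have "poly_map P z $ i / z $ i ^ d \<le> l"
      unfolding l_def by (intro Max_ge) auto
    then show ?thesis
      using pow[OF z] by (simp add: pos_divide_le_eq)
  qed
  have "poly_map P z $ i = l * z $ i ^ d" for i
  proof (rule ccontr)
    assume "poly_map P z $ i \<noteq> l * z $ i ^ d"
    then have "poly_map P z $ i < l * z $ i ^ d"
      using le[of i] by simp
    then obtain y where y: "y \<in> pos_orthant" "\<And>i. poly_map P y $ i < l * y $ i ^ d"
      using poly_map_strict_supersolution[OF irr z le] by blast
    then have "(MAX i. poly_map P y $ i / y $ i ^ d) < l"
      using pow[OF y(1)] by (simp add: pos_divide_less_eq)
    with min[OF y(1)] show False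
      unfolding l_def by linarith
  qed
  with z that show thesis
    by (auto simp: has_positive_eigenvector_def)
qed

section \<open>Comparison with the eigenvector and the two variational formulas\<close>

text \<open>Here \<open>t\<close> is the largest scalar with \<open>t *\<^sub>R u\<close> below
  \<open>x\<close>. At an index \<open>i\<close> where the two touch, monotonicity compares
  \<open>poly_map P x $ i\<close> with \<open>l * x $ i ^ d\<close>.\<close>

lemma eigenvalue_le_some_ratio:
  assumes u: "u \<in> pos_orthant" "\<And>i. poly_map P u $ i = l * u $ i ^ d" and x: "x \<in> pos_orthant"
  shows "\<exists>i. l \<le> poly_map P x $ i / x $ i ^ d"
proof -
  have pos: "0 < u $ i" "0 < x $ i" for i
    using u x by (auto simp: pos_orthant_def)
  define t where "t = (MIN i. x $ i / u $ i)"
  have "t \<in> range (\<lambda>i. x $ i / u $ i)"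
    unfolding t_def by (intro Min_in) auto
  then obtain i where i: "t = x $ i / u $ i"
    by blast
  have t0: "0 < t"
    using pos by (simp add: i)
  have le: "(t *\<^sub>R u) $ k \<le> x $ k" for k
  proof -
    have "t \<le> x $ k / u $ k"
      unfolding t_def by (intro Min_le) auto
    then show ?thesis
      using pos[of k] by (simp add: pos_le_divide_eq)
  qed
  have "l * x $ i ^ d = t ^ d * poly_map P u $ i"
    using pos[of i] by (simp add: i u(2) power_divide)
  also have "\<dots> = mpoly_eval (P $ i) (t *\<^sub>R u)"
    by (simp add: poly_map_def mpoly_eval_scale[OF hom])
  also have "\<dots> \<le> poly_map P x $ i"
    using t0 pos le by (simp add: poly_map_def mpoly_eval_mono[OF nonneg] less_imp_le)
  finally show ?thesis
    using pos[of i] by (intro exI[of _ i]) (simp add: pos_le_divide_eq)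
qed

text \<open>Dual argument: \<open>t\<close> is the smallest scalar with \<open>t *\<^sub>R u\<close>
  above \<open>x\<close>, and the ratio is taken where they touch.\<close>

lemma some_ratio_le_eigenvalue:
  assumes u: "u \<in> pos_orthant" "\<And>i. poly_map P u $ i = l * u $ i ^ d"
    and x: "x \<in> nonneg_orthant - {0}"
  shows "\<exists>i. x $ i \<noteq> 0 \<and> poly_map P x $ i / x $ i ^ d \<le> l"
proof -
  have pos: "0 < u $ i" "0 \<le> x $ i" for i
    using u x by (auto simp: pos_orthant_def nonneg_orthant_def)
  define t where "t = (MAX i. x $ i / u $ i)"
  have "t \<in> range (\<lambda>i. x $ i / u $ i)"
    unfolding t_def by (intro Max_in) auto
  then obtain i where i: "t = x $ i / u $ i"
    by blast
  have t: "x $ k / u $ k \<le> t" for k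
    unfolding t_def by (intro Max_ge) auto
  have le: "x $ k \<le> (t *\<^sub>R u) $ k" for k
    using pos[of k] t[of k] by (simp add: pos_divide_le_eq)
  \<comment> \<open>A nonzero coordinate forces \<open>t\<close> to be positive, so the touching
    coordinate \<open>x $ i\<close> is nonzero and its ratio is admissible.\<close>
  obtain k where "x $ k \<noteq> 0"
    using x by (auto simp: vec_eq_iff)
  then have "0 < x $ k / u $ k"
    using pos[of k] by simp
  with t[of k] have "0 < t"
    by linarith
  with pos[of i] have xi: "0 < x $ i"
    by (simp add: i zero_less_divide_iff)
  have "poly_map P x $ i \<le> mpoly_eval (P $ i) (t *\<^sub>R u)"
    using pos le by (simp add: poly_map_def mpoly_eval_mono[OF nonneg])
  also have "\<dots> = t ^ d * poly_map P u $ i"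
    by (simp add: poly_map_def mpoly_eval_scale[OF hom])
  also have "\<dots> = l * x $ i ^ d"
    using pos[of i] by (simp add: i u(2) power_divide)
  finally show ?thesis
    using xi by (intro exI[of _ i]) (simp add: pos_divide_le_eq)
qed

text \<open>The infimum is attained at the eigenvector \<open>u\<close>, whose ratios all equal
  \<open>l\<close>.\<close>

lemma eigenvalue_eq_INF:
  assumes "has_positive_eigenvector d P l"
  shows "ereal l = (INF x \<in> pos_orthant. ereal (MAX i. poly_map P x $ i / (x $ i) ^ d))"
proof -
  obtain u where u: "u \<in> pos_orthant" "\<And>i. poly_map P u $ i = l * u $ i ^ d"
    using assms by (auto simp: has_positive_eigenvector_def)
  have "u $ i \<noteq> 0" for i
    using u(1) by (metis (mono_tags) mem_Collect_eq less_irrefl pos_orthant_def)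
  then have "(MAX i. poly_map P u $ i / u $ i ^ d) = l"
    by (simp add: u(2))
  then show ?thesis
    using u(1) eigenvalue_le_some_ratio[OF u]
    by (intro antisym INF_greatest INF_lower2[OF u(1)]) (auto simp: Max_ge_iff)
qed

text \<open>The supremum is also attained at \<open>u\<close>; having no zero coordinate,
  \<open>u\<close> has its minimum taken over all indices.\<close>

lemma eigenvalue_eq_SUP:
  assumes "has_positive_eigenvector d P l"
  shows "ereal l = (SUP x \<in> nonneg_orthant - {0}.
    ereal (MIN i \<in> {i. x $ i \<noteq> 0}. poly_map P x $ i / (x $ i) ^ d))"
proof -
  obtain u where u: "u \<in> pos_orthant" "\<And>i. poly_map P u $ i = l * u $ i ^ d"
    using assms by (auto simp: has_positive_eigenvector_def)
  have u0: "0 < u $ i" for i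
    using u(1) by (simp add: pos_orthant_def)
  then have nz: "u $ i \<noteq> 0" for i
    by (metis less_irrefl)
  have mem: "u \<in> nonneg_orthant - {0}"
    using u0 nz by (auto simp: nonneg_orthant_def less_imp_le)
  have "(MIN i \<in> {i. u $ i \<noteq> 0}. poly_map P u $ i / u $ i ^ d) = l"
    using nz by (simp add: u(2))
  moreover have "(MIN i \<in> {i. x $ i \<noteq> 0}. poly_map P x $ i / x $ i ^ d) \<le> l"
    if "x \<in> nonneg_orthant - {0}" for x
    using some_ratio_le_eigenvalue[OF u that] by (subst Min_le_iff) auto
  ultimately show ?thesis
    by (intro antisym SUP_least SUP_upper2[OF mem]) auto
qed

end

theorem corollary4p2:
  fixes P :: "('n::finite real_mpoly) ^ 'n" and d :: nat
  assumes "1 \<le> d"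
    and "\<forall>i. homogeneous d (P $ i)"
    and "\<forall>i. nonneg_coeffs (P $ i)"
    and "weakly_irreducible P"
  shows "(\<exists>!l. has_positive_eigenvector d P l) \<and>
    (\<forall>l. has_positive_eigenvector d P l \<longrightarrow>
      ereal l = (INF x \<in> pos_orthant. ereal (MAX i. poly_map P x $ i / (x $ i) ^ d)) \<and>
      ereal l = (SUP x \<in> nonneg_orthant - {0}.
                   ereal (MIN i \<in> {i. x $ i \<noteq> 0}. poly_map P x $ i / (x $ i) ^ d)))"
proof -
  have ex: "\<exists>l. has_positive_eigenvector d P l"
    using poly_map_positive_eigenvector_exists assms by blast
  have INF: "ereal l = (INF x \<in> pos_orthant. ereal (MAX i. poly_map P x $ i / (x $ i) ^ d))"
    if "has_positive_eigenvector d P l" for l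
    using eigenvalue_eq_INF assms(2,3) that by blast
  \<comment> \<open>Both eigenvalues equal the same infimum, which mentions no eigenvector.\<close>
  have uniq: "l = l'" if "has_positive_eigenvector d P l" "has_positive_eigenvector d P l'" for l l'
    using trans[OF INF[OF that(1)] INF[OF that(2), symmetric]] by simp
  have SUP: "ereal l = (SUP x \<in> nonneg_orthant - {0}.
      ereal (MIN i \<in> {i. x $ i \<noteq> 0}. poly_map P x $ i / (x $ i) ^ d))"
    if "has_positive_eigenvector d P l" for l
    using eigenvalue_eq_SUP assms(2,3) that by blast
  show ?thesis
    using ex uniq INF SUP by blast
qed

end
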